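(* For every $\mu,p_1,p_2\in[0,1]$ with $p_1<\frac12<p_2$ and $p_1<\mu<p_2$, there exists $N$ such that for every number of agents $n\ge N$ the random dictator rule $f(\nu)=\nu$ is the unique regret-minimizing aggregation rule (i.e. the unique minimizer of $\mathrm{Reg}(f)$ over all aggregation rules $f$). Specifically, $$N=\max\left\{\frac{(1-\mu)(p_2-p_1)}{(1-p_2)(\mu-p_1)},\ \frac{\mu(p_2-p_1)}{p_1(p_2-\mu)}\right\}.$$
   Context: Setting: given a number of agents $n\ge 1$, a prior $\mu$ and posteriors $p_1,p_2$ as in the claim, an information structure is a probability distribution $\pi$ on $\{0,1\}\times\{L,H\}^n$, the law of $(\omega,s_1,\dots,s_n)$ (state and binary signals of the $n$ agents), such that $\pi(\omega=1)=\mu$ and, for every $i$, both values of $s_i$ have positive probability and $\pi(\omega=1\mid s_i=L)=p_1$, $\pi(\omega=1\mid s_i=H)=p_2$. Let $\nu\in\{0,\frac1n,\dots,1\}$ be the fraction of agents $i$ with $s_i=H$; $\hat\pi$ is the law of $(\omega,\nu)$ induced by $\pi$, and $\hat\pi_0,\hat\pi_1$ are the conditional laws of $\nu$ given $\omega=0$ and $\omega=1$. An aggregation rule is a function $f:\{0,\frac1n,\dots,1\}\to[0,1]$ ($f(\nu)$ is the probability that the decision maker guesses $\omega=1$ after observing $\nu$); it may depend on $n,\mu,p_1,p_2$ but not on $\pi$. The probability of a correct guess is $P(f,\pi)=\mu\,\mathbb{E}_{\nu\sim\hat\pi_1}[f(\nu)]+(1-\mu)\,\mathbb{E}_{\nu\sim\hat\pi_0}[1-f(\nu)]$;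 that of a Bayesian decision maker who knows $\pi$ is $P^*(\pi)=\mathbb{E}_{\nu\sim\hat\pi}[\max\{\hat\pi(\omega=0\mid\nu),\hat\pi(\omega=1\mid\nu)\}]$. Regret: $\mathrm{Reg}(f,\pi)=P^*(\pi)-P(f,\pi)$ and $\mathrm{Reg}(f)=\max_\pi \mathrm{Reg}(f,\pi)$ over all information structures $\pi$ (with the given $n,\mu,p_1,p_2$). The random dictator rule is $f(\frac kn)=\frac kn$ for $0\le k\le n$.
   Formalization: N is taken in the extended reals and is infinite exactly when p_1=0 or p_2=1; there the formula divides by zero and no finite N works (for p_1=0 the rule 1_{ν=1} has zero regret), so the claim is proved with a finite N precisely for p_1>0 and p_2<1. *)

theory Defs
  imports "HOL-Probability.Probability"
begin

datatype signal = L | H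

text \<open>
  The state \<open>\<omega> = 1\<close> is \<^const>\<open>True\<close>, the state \<open>\<omega> = 0\<close> is \<^const>\<open>False\<close>; the signal of agent
  \<open>i < n\<close> is the entry \<open>s ! i\<close> of the signal profile.
\<close>

definition info_structures :: "nat \<Rightarrow> real \<Rightarrow> real \<Rightarrow> real \<Rightarrow> (bool \<times> signal list) pmf set" where
  "info_structures n \<mu> p1 p2 = {\<pi>.
     set_pmf \<pi> \<subseteq> UNIV \<times> {s. length s = n} \<and>
     \<P>(x in measure_pmf \<pi>. fst x) = \<mu> \<and>
     (\<forall>i<n.
        0 < \<P>(x in measure_pmf \<pi>. snd x ! i = L) \<and>
        0 < \<P>(x in measure_pmf \<pi>. snd x ! i = H) \<and>
        \<P>(x in measure_pmf \<pi>. fst x \<bar> snd x ! i = L) = p1 \<and>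
        \<P>(x in measure_pmf \<pi>. fst x \<bar> snd x ! i = H) = p2)}"

definition high_fraction :: "nat \<Rightarrow> signal list \<Rightarrow> real" where
  "high_fraction n s = real (card {i. i < n \<and> s ! i = H}) / real n"

definition induced_law :: "nat \<Rightarrow> (bool \<times> signal list) pmf \<Rightarrow> (bool \<times> real) pmf" where
  "induced_law n \<pi> = map_pmf (\<lambda>(\<omega>, s). (\<omega>, high_fraction n s)) \<pi>"

text \<open>
  The conditional law of \<open>\<nu>\<close> given the state \<open>\<omega>\<close>. It is meaningful only if \<open>\<omega>\<close> has positive
  probability, which holds whenever the prior lies strictly between \<open>0\<close> and \<open>1\<close>.
\<close>

definition cond_law :: "nat \<Rightarrow> (bool \<times> signal list) pmf \<Rightarrow> bool \<Rightarrow> real pmf" where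
  "cond_law n \<pi> \<omega> = map_pmf snd (cond_pmf (induced_law n \<pi>) {x. fst x = \<omega>})"

definition fractions :: "nat \<Rightarrow> real set" where
  "fractions n = (\<lambda>k. real k / real n) ` {0..n}"

text \<open>
  Rules are functions on \<^term>\<open>fractions n\<close> only: the extensional function space fixes the
  values elsewhere, so that equality of rules is equality on \<^term>\<open>fractions n\<close>.
\<close>

definition aggregation_rules :: "nat \<Rightarrow> (real \<Rightarrow> real) set" where
  "aggregation_rules n = fractions n \<rightarrow>\<^sub>E {0..1}"

definition random_dictator :: "nat \<Rightarrow> real \<Rightarrow> real" where
  "random_dictator n = (\<lambda>\<nu>\<in>fractions n. \<nu>)"

definition prob_correct :: "nat \<Rightarrow> real \<Rightarrow> (real \<Rightarrow> real) \<Rightarrow> (bool \<times> signal list) pmf \<Rightarrow> real" where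
  "prob_correct n \<mu> f \<pi> =
     \<mu> * measure_pmf.expectation (cond_law n \<pi> True) (\<lambda>\<nu>. f \<nu>)
     + (1 - \<mu>) * measure_pmf.expectation (cond_law n \<pi> False) (\<lambda>\<nu>. 1 - f \<nu>)"

definition bayes_prob_correct :: "nat \<Rightarrow> (bool \<times> signal list) pmf \<Rightarrow> real" where
  "bayes_prob_correct n \<pi> =
     measure_pmf.expectation (map_pmf snd (induced_law n \<pi>))
       (\<lambda>\<nu>. max (\<P>(x in measure_pmf (induced_law n \<pi>). \<not> fst x \<bar> snd x = \<nu>))
                 (\<P>(x in measure_pmf (induced_law n \<pi>). fst x \<bar> snd x = \<nu>)))"

definition regret_at :: "nat \<Rightarrow> real \<Rightarrow> (real \<Rightarrow> real) \<Rightarrow> (bool \<times> signal list) pmf \<Rightarrow> real" where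
  "regret_at n \<mu> f \<pi> = bayes_prob_correct n \<pi> - prob_correct n \<mu> f \<pi>"

text \<open>
  The supremum is a maximum, since the information structures form a compact set on which the
  regret is continuous. This set is nonempty when \<open>p1 < \<mu> < p2\<close> (take all signals equal), and
  for rules with values in \<open>[0,1]\<close> the regret is bounded by \<open>1\<close>.
\<close>

definition regret :: "nat \<Rightarrow> real \<Rightarrow> real \<Rightarrow> real \<Rightarrow> (real \<Rightarrow> real) \<Rightarrow> real" where
  "regret n \<mu> p1 p2 f = (SUP \<pi>\<in>info_structures n \<mu> p1 p2. regret_at n \<mu> f \<pi>)"

definition regret_minimizers :: "nat \<Rightarrow> real \<Rightarrow> real \<Rightarrow> real \<Rightarrow> (real \<Rightarrow> real) set" where
  "regret_minimizers n \<mu> p1 p2 =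
     {f. is_arg_min (regret n \<mu> p1 p2) (\<lambda>f. f \<in> aggregation_rules n) f}"

text \<open>
  The threshold is taken in the extended reals. There a positive number divided by \<open>0\<close> is
  \<open>\<infinity>\<close>, so the threshold is infinite in the degenerate cases \<open>p1 = 0\<close> and \<open>p2 = 1\<close>. This is
  not avoidable: if \<open>p1 = 0\<close>, a low signal reveals \<open>\<omega> = 0\<close>, and the rule that guesses
  \<open>\<omega> = 1\<close> exactly if \<open>\<nu> = 1\<close> has regret \<open>0\<close>, so for
  \<open>n \<ge> 2\<close> the random dictator is not the unique minimizer. The case \<open>p2 = 1\<close> is symmetric.
\<close>

definition threshold :: "real \<Rightarrow> real \<Rightarrow> real \<Rightarrow> ereal" where
  "threshold \<mu> p1 p2 =
     max (ereal ((1 - \<mu>) * (p2 - p1)) / ereal ((1 - p2) * (\<mu> - p1)))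
         (ereal (\<mu> * (p2 - p1)) / ereal (p1 * (p2 - \<mu>)))"

end

(*
  All information structures give the random dictator the same probability of a correct guess,
  because the means of nu given each state are determined by mu, p1, p2.  Its regret is thus at
  most the regret R against a fully informed decision maker.  Let f be a rule of regret at most R and
  e = f - id.  If nu has disjoint two-point supports A and B in the two states, then the state is
  revealed, so mu E_A[e] >= (1 - mu) E_B[e].  For n >= N both conditional means lie in
  [1/n, 1 - 1/n], so the supports ({0, n}, {1, n - 1}), ({1, n - 1}, {0, n}) and
  ({1, n}, {0, n - 1}), in units of 1/n, are available.  A positive combination of the three
  inequalities cancels e at the interior points; p1 < 1/2 < p2 fixes the signs of the remaining
  coefficients so that, with e(0) >= 0 >= e(1), e vanishes at these four points.  Pairing {1, n - 1}
  with a support that contains k, for either state, then gives e(k/n) = 0.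
*)
theory Submission
  imports Defs
begin

section \<open>Expectations and conditioning for finitely supported laws\<close>

lemma expectation_of_bool_pmf: "measure_pmf.expectation p (\<lambda>x. of_bool (P x)) = \<P>(x in measure_pmf p. P x)"
proof -
  have "(\<lambda>x. of_bool (P x)) = indicat_real {x. P x}" by (auto simp: indicator_def)
  then show ?thesis by simp
qed

lemma cond_prob_pmf_le_1: "\<P>(x in measure_pmf p. P x \<bar> Q x) \<le> 1"
  by (cases "\<P>(x in measure_pmf p. Q x) = 0")
      (auto simp: cond_prob_def divide_le_eq_1 zero_less_measure_iff intro!: measure_pmf.finite_measure_mono)

lemma prob_pmf_split:
  "\<P>(x in measure_pmf p. Q x)
   = \<P>(x in measure_pmf p. Q x \<and> R x) + \<P>(x in measure_pmf p. Q x \<and> \<not> R x)"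
proof -
  have "{x. Q x} = {x. Q x \<and> R x} \<union> {x. Q x \<and> \<not> R x}" by auto
  then show ?thesis
    using measure_pmf.finite_measure_Union[of "{x. Q x \<and> R x}" p "{x. Q x \<and> \<not> R x}"]
    by (auto simp: disjoint_iff)
qed

text \<open>The product form fits \<open>prob_correct\<close>, where each conditional expectation
  comes multiplied by the probability of its state.\<close>

lemma expectation_cond_pmf:
  fixes g :: "'a \<Rightarrow> real"
  assumes fin: "finite (set_pmf p)" and pos: "measure p S > 0"
  shows "measure p S * measure_pmf.expectation (cond_pmf p S) g
       = measure_pmf.expectation p (\<lambda>x. of_bool (x \<in> S) * g x)"
proof -
  have ne: "set_pmf p \<inter> S \<noteq> {}"
    using pos by (metis measure_Int_set_pmf measure_empty order_less_irrefl inf_commute)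
  have "measure_pmf.expectation (cond_pmf p S) g = (\<Sum>x\<in>set_pmf p. g x * pmf (cond_pmf p S) x)"
    using fin ne by (intro integral_measure_pmf_real) (auto simp: set_cond_pmf)
  also have "measure p S * \<dots> = (\<Sum>x\<in>set_pmf p. (of_bool (x \<in> S) * g x) * pmf p x)"
    unfolding sum_distrib_left using pos ne by (intro sum.cong) (auto simp: pmf_cond)
  also have "\<dots> = measure_pmf.expectation p (\<lambda>x. of_bool (x \<in> S) * g x)"
    using fin by (intro integral_measure_pmf_real[symmetric]) auto
  finally show ?thesis .
qed

lemma expectation_pair_pmf_finite:
  fixes g :: "'a \<times> 'b \<Rightarrow> real"
  assumes "finite (set_pmf p)" "finite (set_pmf q)"
  shows "measure_pmf.expectation (pair_pmf p q) g
       = measure_pmf.expectation p (\<lambda>x. measure_pmf.expectation q (\<lambda>y. g (x, y)))"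
proof -
  have q: "measure_pmf.expectation q h = (\<Sum>y\<in>set_pmf q. h y * pmf q y)" for h :: "'b \<Rightarrow> real"
    using assms by (intro integral_measure_pmf_real) auto
  have p: "measure_pmf.expectation p h = (\<Sum>y\<in>set_pmf p. h y * pmf p y)" for h :: "'a \<Rightarrow> real"
    using assms by (intro integral_measure_pmf_real) auto
  have "measure_pmf.expectation (pair_pmf p q) g
      = (\<Sum>(x, y)\<in>set_pmf p \<times> set_pmf q. g (x, y) * (pmf p x * pmf q y))"
    using assms by (subst integral_measure_pmf_real) (auto simp: pmf_pair intro!: sum.cong)
  also have "\<dots> = measure_pmf.expectation p (\<lambda>x. measure_pmf.expectation q (\<lambda>y. g (x, y)))"
    by (simp add: p q sum.cartesian_product sum_distrib_left mult_ac)
  finally show ?thesis .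
qed

section \<open>Fraction of high signals and cyclic signal profiles\<close>

lemma high_fraction_eq_sum:
  "high_fraction n s = (\<Sum>i<n. of_bool (s ! i = H)) / real n"
proof -
  have "{i. i < n \<and> s ! i = H} = {i\<in>{..<n}. s ! i = H}" by auto
  then show ?thesis
    by (simp add: high_fraction_def of_bool_def sum.If_cases Int_def)
qed

lemma high_fraction_in_fractions: "high_fraction n s \<in> fractions n"
proof -
  have "card {i. i < n \<and> s ! i = H} \<le> card {..<n}" by (intro card_mono) auto
  then show ?thesis unfolding high_fraction_def fractions_def by auto
qed

text \<open>Cyclic shifts of a block of \<open>k\<close> high signals: under a uniform shift \<open>r\<close> every agent
  receives \<^const>\<open>H\<close> with probability \<open>k / n\<close>.\<close>

definition profile :: "nat \<Rightarrow> nat \<Rightarrow> nat \<Rightarrow> signal list" where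
  "profile n k r = map (\<lambda>i. if (i + r) mod n < k then H else L) [0..<n]"

lemma length_profile [simp]: "length (profile n k r) = n"
  by (simp add: profile_def)

lemma nth_profile [simp]: "i < n \<Longrightarrow> profile n k r ! i = (if (i + r) mod n < k then H else L)"
  by (simp add: profile_def)

text \<open>A shift modulo \<open>n\<close> permutes the residues, so the preimage of
  \<open>{..<k}\<close> again has \<open>k\<close> elements.\<close>

lemma card_shift_less:
  fixes n k r :: nat
  assumes "k \<le> n"
  shows "card {i. i < n \<and> (i + r) mod n < k} = k"
proof (cases "n = 0")
  case False
  have inj: "inj_on (\<lambda>i. (i + r) mod n) {..<n}"
  proof (rule inj_onI)
    fix x y assume xy: "x \<in> {..<n}" "y \<in> {..<n}" "(x + r) mod n = (y + r) mod n"
    from xy(3) have "(int x + int r) mod int n = (int y + int r) mod int n"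
      by (metis of_nat_add of_nat_mod)
    then have "int n dvd int x - int y" by (simp add: mod_eq_dvd_iff)
    moreover have "\<bar>int x - int y\<bar> < int n" using xy(1,2) by auto
    ultimately show "x = y" using dvd_imp_le_int[of "int x - int y" "int n"] by force
  qed
  moreover have sub: "(\<lambda>i. (i + r) mod n) ` {..<n} \<subseteq> {..<n}" using False by auto
  ultimately have img: "(\<lambda>i. (i + r) mod n) ` {..<n} = {..<n}"
    by (intro card_subset_eq) (auto simp: card_image)
  have "{..<k} = (\<lambda>i. (i + r) mod n) ` {i. i < n \<and> (i + r) mod n < k}"
  proof (intro equalityI subsetI)
    fix x assume x: "x \<in> {..<k}"
    then have "x \<in> (\<lambda>i. (i + r) mod n) ` {..<n}" using assms img by auto
    then show "x \<in> (\<lambda>i. (i + r) mod n) ` {i. i < n \<and> (i + r) mod n < k}" using x by auto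
  qed auto
  moreover have "inj_on (\<lambda>i. (i + r) mod n) {i. i < n \<and> (i + r) mod n < k}"
    using inj by (rule inj_on_subset) auto
  ultimately show ?thesis by (metis card_image card_lessThan)
qed (use assms in simp)

lemma high_fraction_profile: "k \<le> n \<Longrightarrow> high_fraction n (profile n k r) = real k / real n"
proof -
  assume "k \<le> n"
  moreover have "{i. i < n \<and> profile n k r ! i = H} = {i. i < n \<and> (i + r) mod n < k}" by (auto split: if_splits)
  ultimately show ?thesis by (simp add: high_fraction_def card_shift_less)
qed

text \<open>\<open>i\<close> and \<open>r\<close> enter \<open>(i + r) mod n\<close> symmetrically,
  so counting shifts for a fixed agent is counting agents for a fixed shift.\<close>

lemma sum_profile_nth:
  assumes "k \<le> n" "i < n"
  shows "(\<Sum>r<n. of_bool (profile n k r ! i = H)) = real k"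
proof -
  have "{r \<in> {..<n}. profile n k r ! i = H} = {r. r < n \<and> (r + i) mod n < k}"
    using assms by (auto simp: add.commute)
  then show ?thesis
    using card_shift_less[OF assms(1), of i] by (simp add: of_bool_def sum.If_cases Int_def)
qed

lemma finite_UNIV_signal: "finite (UNIV :: signal set)"
proof -
  have "UNIV = {L, H}" using signal.exhaust by auto
  then show ?thesis by (metis finite.emptyI finite.insertI)
qed

section \<open>Two-point laws and the linear inequalities they impose\<close>

text \<open>The probability of \<open>j\<close> in the law on \<open>{i, j}\<close> with mean
  \<open>m\<close>; \<open>two_point_mean\<close> is the expectation under that law.\<close>

definition upper_weight :: "real \<Rightarrow> nat \<Rightarrow> nat \<Rightarrow> real" where
  "upper_weight m i j = (m - real i) / (real j - real i)"

definition two_point_mean :: "real \<Rightarrow> nat \<Rightarrow> nat \<Rightarrow> (nat \<Rightarrow> real) \<Rightarrow> real" where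
  "two_point_mean m i j g = upper_weight m i j * g j + (1 - upper_weight m i j) * g i"

lemma two_point_mean_of_nat:
  assumes "i < j"
  shows "two_point_mean m i j real = m"
proof -
  have "two_point_mean m i j real = upper_weight m i j * (real j - real i) + real i"
    by (simp add: two_point_mean_def algebra_simps)
  then show ?thesis using assms by (simp add: upper_weight_def)
qed

lemma two_point_mean_const [simp]: "two_point_mean m i' j' (\<lambda>_. c) = c"
  by (simp add: two_point_mean_def algebra_simps)

text \<open>The three inequalities, with weights \<open>w1\<close>, \<open>w2\<close>, \<open>w3\<close> chosen to cancel the interior
  values \<open>u\<close> and \<open>v\<close>, leave only multiples of \<open>e0\<close> and \<open>en\<close>, whose coefficients are read off
  from the common moments of the three inequalities about \<open>0\<close> and about \<open>n\<close>.\<close>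

lemma three_structures_vanish:
  fixes A0 A1 A2 An B0 B1 B2 Bn C1 Cn D0 D2 e0 u v en n :: real
  assumes T1: "B1 * u + B2 * v \<le> A0 * e0 + An * en"
    and T2: "B0 * e0 + Bn * en \<le> A1 * u + A2 * v"
    and T3: "D0 * e0 + D2 * v \<le> C1 * u + Cn * en"
    and nonneg: "0 \<le> A1" "0 \<le> A2" "0 \<le> B1" "0 \<le> B2" "0 < C1" "0 < D2"
    and det: "B2 * A1 < B1 * A2"
    and n: "0 < n"
    and up: "An * n - B1 - B2 * (n - 1) = M" "A1 + A2 * (n - 1) - Bn * n = M"
      "C1 + Cn * n - D2 * (n - 1) = M" "0 < M"
    and down: "B1 * (n - 1) + B2 - A0 * n = K" "B0 * n - A1 * (n - 1) - A2 = K"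
      "D0 * n + D2 - C1 * (n - 1) = K" "0 < K"
    and sign: "0 \<le> e0" "en \<le> 0"
  shows "e0 = 0 \<and> u = 0 \<and> v = 0 \<and> en = 0"
proof -
  \<comment> \<open>Up to sign, the cross product of the coefficient vectors of \<open>u\<close> and
    \<open>v\<close> in the three inequalities, so that both unknowns cancel. \<open>det\<close>
    makes \<open>w3\<close> positive.\<close>
  define w1 where "w1 = A1 * D2 + A2 * C1"
  define w2 where "w2 = B1 * D2 + B2 * C1"
  define w3 where "w3 = B1 * A2 - B2 * A1"
  have w3: "0 < w3" using det by (simp add: w3_def)
  have "0 < B1 * A2" using mult_nonneg_nonneg[OF nonneg(4,1)] det by linarith
  then have ne: "0 < A2" "0 < B1"
    using nonneg(2,3) by (metis less_eq_real_def mult_zero_left mult_zero_right)+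
  have w1: "0 < w1" unfolding w1_def using ne nonneg by (simp add: add_nonneg_pos)
  have w2: "0 < w2" unfolding w2_def using ne nonneg by (simp add: add_pos_nonneg)
  have w: "0 < w1 + w2 + w3" using w1 w2 w3 by simp
  have cu: "w2 * A1 + w3 * C1 = w1 * B1" and cv: "w2 * A2 = w1 * B2 + w3 * D2"
    by (simp_all add: w1_def w2_def w3_def algebra_simps)
  define cn where "cn = w1 * An - w2 * Bn + w3 * Cn"
  define c0 where "c0 = w2 * B0 - w1 * A0 + w3 * D0"
  have cancel: "w1 * B1 - w2 * A1 - w3 * C1 = 0" "w1 * B2 - w2 * A2 + w3 * D2 = 0"
    using cu cv by linarith+
  \<comment> \<open>Substituting the moment equations for the endpoint coefficients leaves
    \<open>(w1 + w2 + w3) * M\<close> plus multiples of the two cancelled sums. The same is done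
    below for \<open>c0\<close> and \<open>K\<close>.\<close>
  have "cn * n = w1 * (An * n) - w2 * (Bn * n) + w3 * (Cn * n)"
    by (simp add: cn_def algebra_simps)
  also have "\<dots> = w1 * (M + B1 + B2 * (n - 1)) - w2 * (A1 + A2 * (n - 1) - M) + w3 * (M - C1 + D2 * (n - 1))"
  proof -
    have "An * n = M + B1 + B2 * (n - 1)" "Bn * n = A1 + A2 * (n - 1) - M"
      "Cn * n = M - C1 + D2 * (n - 1)" using up by linarith+
    then show ?thesis by simp
  qed
  also have "\<dots> = (w1 + w2 + w3) * M + (w1 * B1 - w2 * A1 - w3 * C1)
      + (n - 1) * (w1 * B2 - w2 * A2 + w3 * D2)" by (simp add: algebra_simps)
  also have "\<dots> = (w1 + w2 + w3) * M" by (simp add: cancel)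
  finally have "0 < cn * n" using mult_pos_pos[OF w up(4)] by linarith
  then have cn: "0 < cn" using n by (simp add: zero_less_mult_iff)
  have "c0 * n = w2 * (B0 * n) - w1 * (A0 * n) + w3 * (D0 * n)"
    by (simp add: c0_def algebra_simps)
  also have "\<dots> = w2 * (K + A1 * (n - 1) + A2) - w1 * (B1 * (n - 1) + B2 - K) + w3 * (K - D2 + C1 * (n - 1))"
  proof -
    have "B0 * n = K + A1 * (n - 1) + A2" "A0 * n = B1 * (n - 1) + B2 - K"
      "D0 * n = K - D2 + C1 * (n - 1)" using down by linarith+
    then show ?thesis by simp
  qed
  also have "\<dots> = (w1 + w2 + w3) * K - (n - 1) * (w1 * B1 - w2 * A1 - w3 * C1)
      - (w1 * B2 - w2 * A2 + w3 * D2)" by (simp add: algebra_simps)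
  also have "\<dots> = (w1 + w2 + w3) * K" by (simp add: cancel)
  finally have "0 < c0 * n" using mult_pos_pos[OF w down(4)] by linarith
  then have c0: "0 < c0" using n by (simp add: zero_less_mult_iff)
  have "w1 * (B1 * u + B2 * v) + w2 * (B0 * e0 + Bn * en) + w3 * (D0 * e0 + D2 * v)
      \<le> w1 * (A0 * e0 + An * en) + w2 * (A1 * u + A2 * v) + w3 * (C1 * u + Cn * en)"
    using mult_left_mono[OF T1, of w1] mult_left_mono[OF T2, of w2] mult_left_mono[OF T3, of w3]
      w1 w2 w3 by linarith
  then have "c0 * e0 + (w1 * B1 - w2 * A1 - w3 * C1) * u + (w1 * B2 - w2 * A2 + w3 * D2) * v \<le> cn * en"
    unfolding c0_def cn_def by (simp only: ring_distribs mult.assoc)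
  then have le: "c0 * e0 \<le> cn * en" by (simp add: cancel)
  have "0 \<le> c0 * e0" "cn * en \<le> 0" using c0 cn sign by (simp_all add: mult_nonneg_nonpos)
  with le have "c0 * e0 = 0" "cn * en = 0" by linarith+
  with c0 cn have zero: "e0 = 0" "en = 0" by auto
  \<comment> \<open>Once \<open>e0 = en = 0\<close>, the weighted inequalities sum to zero, so
    \<open>T1\<close> and \<open>T2\<close> are tight: \<open>u\<close> and \<open>v\<close> solve a
    homogeneous system of determinant \<open>w3\<close>.\<close>
  define t1 where "t1 = B1 * u + B2 * v"
  define t2 where "t2 = A1 * u + A2 * v"
  have t: "t1 \<le> 0" "0 \<le> t2" "0 \<le> C1 * u - D2 * v"
    using T1 T2 T3 by (simp_all add: zero t1_def t2_def)
  have "w1 * t1 - w2 * t2 - w3 * (C1 * u - D2 * v)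
      = (w1 * B1 - w2 * A1 - w3 * C1) * u + (w1 * B2 - w2 * A2 + w3 * D2) * v"
    by (simp add: t1_def t2_def algebra_simps)
  also have "\<dots> = 0" by (simp add: cancel)
  finally have "w1 * t1 = w2 * t2 + w3 * (C1 * u - D2 * v)" by simp
  moreover have "w1 * t1 \<le> 0" "0 \<le> w2 * t2" "0 \<le> w3 * (C1 * u - D2 * v)"
    using t w1 w2 w3 by (simp_all add: mult_nonneg_nonpos)
  ultimately have "w1 * t1 = 0" "w2 * t2 = 0" by linarith+
  with w1 w2 have t0: "t1 = 0" "t2 = 0" by auto
  have "w3 * u = A2 * t1 - B2 * t2" "w3 * v = B1 * t2 - A1 * t1"
    by (simp_all add: w3_def t1_def t2_def algebra_simps)
  with w3 t0 zero show ?thesis by simp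
qed

lemma scaled_two_point_mean:
  assumes "i < j"
  shows "c * two_point_mean m i j g
    = c * (real j - m) / (real j - real i) * g i + c * (m - real i) / (real j - real i) * g j"
proof -
  have "1 - upper_weight m i j = (real j - m) / (real j - real i)"
    using assms by (simp add: upper_weight_def field_simps)
  then show ?thesis by (simp add: two_point_mean_def upper_weight_def distrib_left)
qed

text \<open>\<open>a\<close> and \<open>b\<close> stand for the mean number of high signals in state
  1 and in state 0, \<open>e\<close> for the deviation from the random dictator. \<open>up\<close>
  and \<open>down\<close> become the positivity of \<open>M\<close> and \<open>K\<close> in
  \<open>three_structures_vanish\<close>.\<close>

lemma two_point_inequalities_imp_zero:
  fixes e :: "nat \<Rightarrow> real" and n :: nat and a b \<mu> :: real
  assumes ineq: "\<And>i j k l. \<lbrakk>i < j; j \<le> n; real i \<le> a; a \<le> real j;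
      k < l; l \<le> n; real k \<le> b; b \<le> real l; {i, j} \<inter> {k, l} = {}\<rbrakk>
      \<Longrightarrow> (1 - \<mu>) * two_point_mean b k l e \<le> \<mu> * two_point_mean a i j e"
    and ab: "1 \<le> b" "b < a" "a \<le> real n - 1"
    and \<mu>: "0 < \<mu>" "\<mu> < 1"
    and up: "(1 - \<mu>) * b < \<mu> * a"
    and down: "\<mu> * (real n - a) < (1 - \<mu>) * (real n - b)"
    and ends: "0 \<le> e 0" "e n \<le> 0"
    and k: "k \<le> n"
  shows "e k = 0"
proof -
  define N where "N = real n"
  have N: "2 < N" using ab by (simp add: N_def)
  then have n: "2 < n" by (simp add: N_def)
  then have n1: "real (n - 1) = N - 1" by (simp add: N_def)
  have abN: "a \<le> N - 1" using ab by (simp add: N_def)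
  have T1: "(1 - \<mu>) * two_point_mean b 1 (n - 1) e \<le> \<mu> * two_point_mean a 0 n e"
    and T2: "(1 - \<mu>) * two_point_mean b 0 n e \<le> \<mu> * two_point_mean a 1 (n - 1) e"
    and T3: "(1 - \<mu>) * two_point_mean b 0 (n - 1) e \<le> \<mu> * two_point_mean a 1 n e"
    using ab abN n n1 N by (auto intro!: ineq simp: N_def)
  have z: "e 0 = 0 \<and> e 1 = 0 \<and> e (n - 1) = 0 \<and> e n = 0"
  proof (rule three_structures_vanish)
    show "(1 - \<mu>) * (N - 1 - b) / (N - 2) * e 1 + (1 - \<mu>) * (b - 1) / (N - 2) * e (n - 1)
        \<le> \<mu> * (N - a) / N * e 0 + \<mu> * a / N * e n"
      using T1 n by (simp add: scaled_two_point_mean n1 N_def[symmetric])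
    show "(1 - \<mu>) * (N - b) / N * e 0 + (1 - \<mu>) * b / N * e n
        \<le> \<mu> * (N - 1 - a) / (N - 2) * e 1 + \<mu> * (a - 1) / (N - 2) * e (n - 1)"
      using T2 n by (simp add: scaled_two_point_mean n1 N_def[symmetric])
    show "(1 - \<mu>) * (N - 1 - b) / (N - 1) * e 0 + (1 - \<mu>) * b / (N - 1) * e (n - 1)
        \<le> \<mu> * (N - a) / (N - 1) * e 1 + \<mu> * (a - 1) / (N - 1) * e n"
      using T3 n by (simp add: scaled_two_point_mean n1 N_def[symmetric])
    \<comment> \<open>Cleared of denominators, the determinant condition is
      \<open>0 < (N - 2) * (a - b)\<close>.\<close>
    have "(1 - \<mu>) * \<mu> * ((b - 1) * (N - 1 - a)) < (1 - \<mu>) * \<mu> * ((N - 1 - b) * (a - 1))"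
    proof (rule mult_strict_left_mono)
      have "(N - 1 - b) * (a - 1) - (b - 1) * (N - 1 - a) = (N - 2) * (a - b)"
        by (simp add: algebra_simps)
      moreover have "0 < (N - 2) * (a - b)" using N ab by simp
      ultimately show "(b - 1) * (N - 1 - a) < (N - 1 - b) * (a - 1)" by linarith
    qed (use \<mu> in simp)
    then have "(1 - \<mu>) * \<mu> * ((b - 1) * (N - 1 - a)) / ((N - 2) * (N - 2))
        < (1 - \<mu>) * \<mu> * ((N - 1 - b) * (a - 1)) / ((N - 2) * (N - 2))"
      using N by (intro divide_strict_right_mono) auto
    then show "(1 - \<mu>) * (b - 1) / (N - 2) * (\<mu> * (N - 1 - a) / (N - 2))
        < (1 - \<mu>) * (N - 1 - b) / (N - 2) * (\<mu> * (a - 1) / (N - 2))"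
      by (simp add: mult_ac)
    have ne: "N \<noteq> 0" "N - 1 \<noteq> 0" "N - 2 \<noteq> 0" using N by auto
    \<comment> \<open>Moments about 0 and about \<open>N\<close> of mass \<open>c\<close> on
      \<open>{1, N - 1}\<close> with mean \<open>x\<close>. \<open>split1\<close> does this for
      \<open>{1, N}\<close> about 0 and for \<open>{0, N - 1}\<close> about
      \<open>N\<close>.\<close>
    have split: "c * (N - 1 - x) / (N - 2) + c * (x - 1) / (N - 2) * (N - 1) = c * x"
      "c * (N - 1 - x) / (N - 2) * (N - 1) + c * (x - 1) / (N - 2) = c * (N - x)" for c x
    proof -
      have "c * (N - 1 - x) / (N - 2) + c * (x - 1) / (N - 2) * (N - 1) = (c * x) * (N - 2) / (N - 2)"
        by (simp only: times_divide_eq_left add_divide_distrib[symmetric]) (simp add: algebra_simps)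
      then show "c * (N - 1 - x) / (N - 2) + c * (x - 1) / (N - 2) * (N - 1) = c * x" using ne by simp
      have "c * (N - 1 - x) / (N - 2) * (N - 1) + c * (x - 1) / (N - 2) = c * (N - x) * (N - 2) / (N - 2)"
        by (simp only: times_divide_eq_left add_divide_distrib[symmetric]) (simp add: algebra_simps)
      then show "c * (N - 1 - x) / (N - 2) * (N - 1) + c * (x - 1) / (N - 2) = c * (N - x)" using ne by simp
    qed
    have split1: "c * (N - x) / (N - 1) + c * (x - 1) / (N - 1) * N = c * x"
      "c * (N - 1 - x) / (N - 1) * N + c * x / (N - 1) = c * (N - x)" for c x
    proof -
      have "c * (N - x) / (N - 1) + c * (x - 1) / (N - 1) * N = (c * x) * (N - 1) / (N - 1)"
        by (simp only: times_divide_eq_left add_divide_distrib[symmetric]) (simp add: algebra_simps)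
      then show "c * (N - x) / (N - 1) + c * (x - 1) / (N - 1) * N = c * x" using ne by simp
      have "c * (N - 1 - x) / (N - 1) * N + c * x / (N - 1) = c * (N - x) * (N - 1) / (N - 1)"
        by (simp only: times_divide_eq_left add_divide_distrib[symmetric]) (simp add: algebra_simps)
      then show "c * (N - 1 - x) / (N - 1) * N + c * x / (N - 1) = c * (N - x)" using ne by simp
    qed
    show "\<mu> * a / N * N - (1 - \<mu>) * (N - 1 - b) / (N - 2) - (1 - \<mu>) * (b - 1) / (N - 2) * (N - 1)
        = \<mu> * a - (1 - \<mu>) * b"
      using split(1)[of "1 - \<mu>" b] ne by simp
    show "\<mu> * (N - 1 - a) / (N - 2) + \<mu> * (a - 1) / (N - 2) * (N - 1) - (1 - \<mu>) * b / N * N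
        = \<mu> * a - (1 - \<mu>) * b"
      using split(1)[of \<mu> a] ne by simp
    show "\<mu> * (N - a) / (N - 1) + \<mu> * (a - 1) / (N - 1) * N - (1 - \<mu>) * b / (N - 1) * (N - 1)
        = \<mu> * a - (1 - \<mu>) * b"
      using split1(1)[of \<mu> a] ne by simp
    show "(1 - \<mu>) * (N - 1 - b) / (N - 2) * (N - 1) + (1 - \<mu>) * (b - 1) / (N - 2) - \<mu> * (N - a) / N * N
        = (1 - \<mu>) * (N - b) - \<mu> * (N - a)"
      using split(2)[of "1 - \<mu>" b] ne by simp
    show "(1 - \<mu>) * (N - b) / N * N - \<mu> * (N - 1 - a) / (N - 2) * (N - 1) - \<mu> * (a - 1) / (N - 2)
        = (1 - \<mu>) * (N - b) - \<mu> * (N - a)"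
      using split(2)[of \<mu> a] ne by simp
    show "(1 - \<mu>) * (N - 1 - b) / (N - 1) * N + (1 - \<mu>) * b / (N - 1) - \<mu> * (N - a) / (N - 1) * (N - 1)
        = (1 - \<mu>) * (N - b) - \<mu> * (N - a)"
      using split1(2)[of "1 - \<mu>" b] ne by simp
  qed (use N ab abN \<mu> up down ends in \<open>auto simp: N_def\<close>)
  show ?thesis
  proof (cases "k \<in> {0, 1, n - 1, n}")
    case False
    with k have k': "1 < k" "k < n - 1" by auto
    have rk: "0 < real k" "real k < N" using k' by (auto simp: N_def)
    have n2: "1 < n - 1" "n - 1 \<le> n" "real 1 \<le> b" "real 1 \<le> a" "b \<le> real (n - 1)" "a \<le> real (n - 1)"
      using n ab abN n1 by auto
    \<comment> \<open>In state 0 the support \<open>{1, n - 1}\<close> contributes nothing. In state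
      1, \<open>k\<close> is paired with the end on the other side of \<open>a\<close>; as
      \<open>1 < a \<le> n - 1\<close>, it has positive weight. For \<open>e k \<le> 0\<close> the
      states swap roles.\<close>
    have "0 \<le> e k"
    proof (cases "a \<le> real k")
      case True
      have "(1 - \<mu>) * two_point_mean b 1 (n - 1) e \<le> \<mu> * two_point_mean a 0 k e"
        using n2 k' True ab by (intro ineq) auto
      then show ?thesis
        using z k' ab \<mu> by (simp add: two_point_mean_def upper_weight_def zero_le_mult_iff zero_le_divide_iff)
    next
      case False
      have "(1 - \<mu>) * two_point_mean b 1 (n - 1) e \<le> \<mu> * two_point_mean a k n e"
        using n2 k' False ab by (intro ineq) auto
      then show ?thesis
        using z k' abN \<mu> rk n1 False
        by (simp add: scaled_two_point_mean N_def zero_le_mult_iff zero_le_divide_iff mult_le_0_iff)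
    qed
    moreover have "e k \<le> 0"
    proof (cases "b \<le> real k")
      case True
      have "(1 - \<mu>) * two_point_mean b 0 k e \<le> \<mu> * two_point_mean a 1 (n - 1) e"
        using n2 k' True ab by (intro ineq) auto
      then show ?thesis
        using z k' ab \<mu> by (simp add: two_point_mean_def upper_weight_def mult_le_0_iff divide_le_0_iff)
    next
      case False
      have "(1 - \<mu>) * two_point_mean b k n e \<le> \<mu> * two_point_mean a 1 (n - 1) e"
        using n2 k' False ab by (intro ineq) auto
      then show ?thesis
        using z k' ab abN \<mu> rk n1 False
        by (simp add: scaled_two_point_mean N_def mult_le_0_iff divide_le_0_iff)
    qed
    ultimately show ?thesis by simp
  qed (use z in auto)
qed

section \<open>Signal constraints and the constant score of the random dictator\<close>

locale aggregation_problem =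
  fixes n :: nat and \<mu> p1 p2 :: real
  assumes n_pos: "0 < n"
    and p1_pos: "0 < p1" and p2_less_1: "p2 < 1"
    and p1_less_\<mu>: "p1 < \<mu>" and \<mu>_less_p2: "\<mu> < p2"
begin

text \<open>The probability of a high signal, forced by the posteriors averaging to the prior.
  \<open>high_mass\<close> and \<open>false_high_mass\<close> are the joint probabilities of a high
  signal with state 1 and state 0.\<close>

definition "high_prob = (\<mu> - p1) / (p2 - p1)"
definition "high_mass = high_prob * p2"
definition "false_high_mass = high_prob * (1 - p2)"

lemma \<mu>_bounds: "0 < \<mu>" "\<mu> < 1"
  using p1_pos p2_less_1 p1_less_\<mu> \<mu>_less_p2 by linarith+

lemma high_prob_bounds: "0 < high_prob" "high_prob < 1"
  using p1_less_\<mu> \<mu>_less_p2 by (auto simp: high_prob_def field_simps)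

lemma prior_split: "high_prob * p2 + (1 - high_prob) * p1 = \<mu>"
proof -
  have "high_prob * (p2 - p1) = \<mu> - p1"
    using p1_less_\<mu> \<mu>_less_p2 by (simp add: high_prob_def)
  then show ?thesis by (simp add: algebra_simps)
qed

lemma finite_info_structure: "\<pi> \<in> info_structures n \<mu> p1 p2 \<Longrightarrow> finite (set_pmf \<pi>)"
proof -
  assume "\<pi> \<in> info_structures n \<mu> p1 p2"
  then have sub: "set_pmf \<pi> \<subseteq> UNIV \<times> {s. set s \<subseteq> UNIV \<and> length s = n}"
    by (auto simp: info_structures_def)
  have "finite (UNIV \<times> {s. set s \<subseteq> (UNIV :: signal set) \<and> length s = n} :: (bool \<times> signal list) set)"
    by (intro finite_cartesian_product finite_lists_length_eq finite_UNIV_signal) simp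
  then show ?thesis using sub by (rule rev_finite_subset)
qed

text \<open>Total probability, \<open>\<mu> = p2 * q + p1 * (1 - q)\<close>, determines the
  probability \<open>q\<close> of a high signal, and the posterior then fixes both joint
  masses.\<close>

lemma signal_masses:
  assumes pi: "\<pi> \<in> info_structures n \<mu> p1 p2" and i: "i < n"
  shows "\<P>(x in measure_pmf \<pi>. fst x \<and> snd x ! i = H) = high_mass"
    and "\<P>(x in measure_pmf \<pi>. \<not> fst x \<and> snd x ! i = H) = false_high_mass"
proof -
  let ?P = "\<lambda>Q. \<P>(x in measure_pmf \<pi>. Q x)"
  note add = prob_pmf_split[of \<pi>]
  have LH: "s = L \<longleftrightarrow> s \<noteq> H" for s by (cases s) auto
  from pi i have *: "?P fst = \<mu>" "0 < ?P (\<lambda>x. snd x ! i = L)" "0 < ?P (\<lambda>x. snd x ! i = H)"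
    "\<P>(x in measure_pmf \<pi>. fst x \<bar> snd x ! i = L) = p1"
    "\<P>(x in measure_pmf \<pi>. fst x \<bar> snd x ! i = H) = p2"
    by (auto simp: info_structures_def)
  define q where "q = ?P (\<lambda>x. snd x ! i = H)"
  have h: "?P (\<lambda>x. fst x \<and> snd x ! i = H) = p2 * q"
    using *(3,5) by (simp add: cond_prob_def q_def field_simps)
  have pos_neg: "?P (\<lambda>x. fst x \<and> snd x ! i = H) + ?P (\<lambda>x. \<not> fst x \<and> snd x ! i = H) = q"
    using add[of "\<lambda>x. snd x ! i = H" fst] by (simp add: q_def conj_commute)
  have l: "?P (\<lambda>x. fst x \<and> snd x ! i \<noteq> H) = p1 * ?P (\<lambda>x. snd x ! i \<noteq> H)"
    using *(2,4) by (simp add: cond_prob_def LH field_simps)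
  have q1: "?P (\<lambda>x. snd x ! i \<noteq> H) = 1 - q"
    using add[of "\<lambda>_. True" "\<lambda>x. snd x ! i = H"] by (simp add: q_def)
  have "\<mu> = p2 * q + p1 * (1 - q)"
    using add[of fst "\<lambda>x. snd x ! i = H"] *(1) h l q1 by simp
  then have q: "q = high_prob"
    using p1_less_\<mu> \<mu>_less_p2 by (simp add: high_prob_def field_simps)
  show "?P (\<lambda>x. fst x \<and> snd x ! i = H) = high_mass" using h q by (simp add: high_mass_def)
  show "?P (\<lambda>x. \<not> fst x \<and> snd x ! i = H) = false_high_mass"
    using pos_neg h q by (simp add: false_high_mass_def algebra_simps)
qed

text \<open>The prior weights undo the conditioning on the state, leaving a single expectation over
  \<pi>.\<close>

lemma prob_correct_eq:
  assumes pi: "\<pi> \<in> info_structures n \<mu> p1 p2"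
  shows "prob_correct n \<mu> f \<pi> = measure_pmf.expectation \<pi>
     (\<lambda>x. if fst x then f (high_fraction n (snd x)) else 1 - f (high_fraction n (snd x)))"
proof -
  let ?p = "induced_law n \<pi>"
  have fin: "finite (set_pmf \<pi>)" by (rule finite_info_structure[OF pi])
  have fin': "finite (set_pmf ?p)" using fin by (simp add: induced_law_def)
  have int: "integrable (measure_pmf \<pi>) g" for g :: "_ \<Rightarrow> real"
    using fin by (rule integrable_measure_pmf_finite)
  have 1: "measure ?p {x. fst x = True} = \<mu>"
  proof -
    have "\<P>(x in measure_pmf \<pi>. fst x) = \<mu>" using pi by (simp add: info_structures_def)
    moreover have "(\<lambda>(\<omega>, s). (\<omega>, high_fraction n s)) -` {x. fst x = True} = {x. fst x}" by auto
    ultimately show ?thesis by (simp add: induced_law_def)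
  qed
  have 0: "measure ?p {x. fst x = False} = 1 - \<mu>"
  proof -
    have "{x :: bool \<times> real. fst x = False} = - {x. fst x = True}" by auto
    then show ?thesis using 1 measure_pmf.prob_compl[of "{x. fst x = True}" ?p]
      by (simp add: Compl_eq_Diff_UNIV)
  qed
  have c: "measure ?p {x. fst x = \<omega>} * measure_pmf.expectation (cond_law n \<pi> \<omega>) g
      = measure_pmf.expectation \<pi> (\<lambda>x. of_bool (fst x = \<omega>) * g (high_fraction n (snd x)))"
    if "measure ?p {x. fst x = \<omega>} > 0" for \<omega> g
    using expectation_cond_pmf[OF fin' that, of "\<lambda>x. g (snd x)"]
    by (simp add: cond_law_def) (simp add: induced_law_def case_prod_beta)
  show ?thesis
    using c[of True f] c[of False "\<lambda>\<nu>. 1 - f \<nu>"] \<mu>_bounds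
    unfolding prob_correct_def 0 1
    by (simp add: Bochner_Integration.integral_add[OF int int, symmetric] del: Bochner_Integration.integral_add)
      (auto intro!: Bochner_Integration.integral_cong)
qed

lemma bayes_le_1: "bayes_prob_correct n \<pi> \<le> 1"
proof -
  have "0 \<le> max \<P>(x in measure_pmf p. P x \<bar> Q x) \<P>(x in measure_pmf p. R x \<bar> Q x)"
    for p :: "(bool \<times> real) pmf" and P Q R
    by (auto simp: cond_prob_def le_max_iff_disj)
  then show ?thesis unfolding bayes_prob_correct_def
    by (intro measure_pmf.integral_le_const measure_pmf.integrable_const_bound[where B=1])
       (auto simp: cond_prob_pmf_le_1 abs_of_nonneg simp del: abs_le_iff intro!: AE_pmfI)
qed

text \<open>If the fraction reveals the state on the support, one of the two posteriors is 1 almost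
  surely.\<close>

lemma bayes_eq_1:
  assumes "\<And>x y. x \<in> set_pmf \<pi> \<Longrightarrow> y \<in> set_pmf \<pi> \<Longrightarrow>
    high_fraction n (snd x) = high_fraction n (snd y) \<Longrightarrow> fst x = fst y"
  shows "bayes_prob_correct n \<pi> = 1"
proof -
  let ?p = "induced_law n \<pi>"
  have cp: "\<P>(x in measure_pmf ?p. P x \<bar> snd x = \<nu>) = 1"
    if "y \<in> set_pmf ?p" "snd y = \<nu>" "\<And>x. x \<in> set_pmf ?p \<Longrightarrow> snd x = \<nu> \<Longrightarrow> P x" for P y \<nu>
  proof -
    have "\<P>(x in measure_pmf ?p. P x \<and> snd x = \<nu>) = \<P>(x in measure_pmf ?p. snd x = \<nu>)"
      using that(3) by (intro measure_pmf.finite_measure_eq_AE) (auto simp: AE_measure_pmf_iff)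
    moreover have "\<P>(x in measure_pmf ?p. snd x = \<nu>) > 0"
      using that(1,2) by (auto simp: measure_pmf_posI)
    ultimately show ?thesis by (simp add: cond_prob_def)
  qed
  have *: "max \<P>(x in measure_pmf ?p. \<not> fst x \<bar> snd x = \<nu>) \<P>(x in measure_pmf ?p. fst x \<bar> snd x = \<nu>) = 1"
    if "\<nu> \<in> set_pmf (map_pmf snd ?p)" for \<nu>
  proof -
    from that obtain y where y: "y \<in> set_pmf ?p" "snd y = \<nu>" by auto
    have "fst x = fst y" if "x \<in> set_pmf ?p" "snd x = \<nu>" for x
      using assms y that unfolding induced_law_def by fastforce
    then consider "\<And>x. x \<in> set_pmf ?p \<Longrightarrow> snd x = \<nu> \<Longrightarrow> fst x"
      | "\<And>x. x \<in> set_pmf ?p \<Longrightarrow> snd x = \<nu> \<Longrightarrow> \<not> fst x"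
      by (cases "fst y") auto
    then show ?thesis
    proof cases
      case 1
      have "\<P>(x in measure_pmf ?p. fst x \<bar> snd x = \<nu>) = 1" using y 1 by (rule cp)
      then show ?thesis by (simp add: cond_prob_pmf_le_1 max_absorb2)
    next
      case 2
      have "\<P>(x in measure_pmf ?p. \<not> fst x \<bar> snd x = \<nu>) = 1" using y 2 by (rule cp)
      then show ?thesis by (simp add: cond_prob_pmf_le_1 max_absorb1)
    qed
  qed
  have "bayes_prob_correct n \<pi> = measure_pmf.expectation (map_pmf snd ?p) (\<lambda>_. 1)"
    unfolding bayes_prob_correct_def using * by (intro integral_cong_AE) (auto simp: AE_measure_pmf_iff)
  then show ?thesis by simp
qed


text \<open>By linearity only the joint law of the state with each single signal matters, whatever
  the correlation between agents.\<close>

lemma expectation_state_fraction: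
  assumes pi: "\<pi> \<in> info_structures n \<mu> p1 p2"
  shows "measure_pmf.expectation \<pi> (\<lambda>x. of_bool (fst x) * high_fraction n (snd x)) = high_mass"
    and "measure_pmf.expectation \<pi> (\<lambda>x. of_bool (\<not> fst x) * high_fraction n (snd x)) = false_high_mass"
proof -
  have int: "integrable (measure_pmf \<pi>) g" for g :: "_ \<Rightarrow> real"
    using finite_info_structure[OF pi] by (rule integrable_measure_pmf_finite)
  have "measure_pmf.expectation \<pi> (\<lambda>x. of_bool (Q (fst x)) * high_fraction n (snd x))
      = (\<Sum>i<n. \<P>(x in measure_pmf \<pi>. Q (fst x) \<and> snd x ! i = H)) / real n" for Q
  proof -
    have "measure_pmf.expectation \<pi> (\<lambda>x. of_bool (Q (fst x)) * high_fraction n (snd x))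
        = measure_pmf.expectation \<pi> (\<lambda>x. (\<Sum>i<n. of_bool (Q (fst x) \<and> snd x ! i = H)) / real n)"
      by (simp add: high_fraction_eq_sum sum_distrib_left of_bool_conj del: sum_of_bool_eq)
    also have "\<dots> = (\<Sum>i<n. \<P>(x in measure_pmf \<pi>. Q (fst x) \<and> snd x ! i = H)) / real n"
      by (simp only: Bochner_Integration.integral_divide_zero Bochner_Integration.integral_sum[OF int]
          expectation_of_bool_pmf)
    finally show ?thesis .
  qed
  from this[of "\<lambda>b. b"] this[of Not] show
    "measure_pmf.expectation \<pi> (\<lambda>x. of_bool (fst x) * high_fraction n (snd x)) = high_mass"
    "measure_pmf.expectation \<pi> (\<lambda>x. of_bool (\<not> fst x) * high_fraction n (snd x)) = false_high_mass"
    using signal_masses[OF pi] n_pos by simp_all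
qed

text \<open>The probability that the random dictator guesses correctly, the same for all information
  structures.\<close>

definition "dictator_score = high_mass + (1 - \<mu>) - false_high_mass"

text \<open>The score is affine in the rule, so only the deviation from the random dictator
  contributes a term that depends on the structure beyond the given parameters.\<close>

lemma prob_correct_split:
  assumes pi: "\<pi> \<in> info_structures n \<mu> p1 p2"
  shows "prob_correct n \<mu> f \<pi> = dictator_score + measure_pmf.expectation \<pi>
     (\<lambda>x. (if fst x then 1 else - 1) * (f (high_fraction n (snd x)) - high_fraction n (snd x)))"
proof -
  have int: "integrable (measure_pmf \<pi>) g" for g :: "_ \<Rightarrow> real"
    using finite_info_structure[OF pi] by (rule integrable_measure_pmf_finite)
  have \<mu>: "measure_pmf.expectation \<pi> (\<lambda>x. of_bool (fst x)) = \<mu>"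
    using pi by (simp add: expectation_of_bool_pmf info_structures_def)
  have "prob_correct n \<mu> f \<pi> = measure_pmf.expectation \<pi> (\<lambda>x.
      of_bool (fst x) * high_fraction n (snd x) + (1 - of_bool (fst x))
      - of_bool (\<not> fst x) * high_fraction n (snd x)
      + (if fst x then 1 else - 1) * (f (high_fraction n (snd x)) - high_fraction n (snd x)))"
    unfolding prob_correct_eq[OF pi] by (rule Bochner_Integration.integral_cong) auto
  also have "\<dots> = dictator_score + measure_pmf.expectation \<pi>
     (\<lambda>x. (if fst x then 1 else - 1) * (f (high_fraction n (snd x)) - high_fraction n (snd x)))"
    by (simp only: Bochner_Integration.integral_add[OF int int] Bochner_Integration.integral_diff[OF int int]
        expectation_state_fraction[OF pi] \<mu> dictator_score_def) simp
  finally show ?thesis .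
qed

lemma regret_random_dictator_le:
  assumes ne: "info_structures n \<mu> p1 p2 \<noteq> {}"
  shows "regret n \<mu> p1 p2 (random_dictator n) \<le> 1 - dictator_score"
  unfolding regret_def
proof (rule cSUP_least[OF ne])
  fix \<pi> assume pi: "\<pi> \<in> info_structures n \<mu> p1 p2"
  have "prob_correct n \<mu> (random_dictator n) \<pi> = dictator_score"
    by (simp add: prob_correct_split[OF pi] random_dictator_def high_fraction_in_fractions)
  then show "regret_at n \<mu> (random_dictator n) \<pi> \<le> 1 - dictator_score"
    using bayes_le_1[of \<pi>] by (simp add: regret_at_def)
qed

text \<open>A real supremum is an upper bound only of a bounded family; here 1 is a bound because
  the rule takes values in \<open>{0..1}\<close>.\<close>

lemma regret_at_le_regret:
  assumes f: "f \<in> aggregation_rules n" and pi: "\<pi> \<in> info_structures n \<mu> p1 p2"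
  shows "regret_at n \<mu> f \<pi> \<le> regret n \<mu> p1 p2 f"
  unfolding regret_def
proof (rule cSUP_upper[OF pi])
  show "bdd_above (regret_at n \<mu> f ` info_structures n \<mu> p1 p2)"
  proof (rule bdd_aboveI2)
    fix \<pi> assume pi: "\<pi> \<in> info_structures n \<mu> p1 p2"
    have "f (high_fraction n s) \<in> {0..1}" for s
      using f high_fraction_in_fractions unfolding aggregation_rules_def by (rule PiE_mem)
    then have "0 \<le> prob_correct n \<mu> f \<pi>"
      unfolding prob_correct_eq[OF pi] by (intro Bochner_Integration.integral_nonneg) auto
    then show "regret_at n \<mu> f \<pi> \<le> 1" using bayes_le_1[of \<pi>] by (simp add: regret_at_def)
  qed
qed

section \<open>Information structures with two-point supports\<close>

text \<open>Conditional means of the number, not the fraction, of high signals.\<close>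

definition "true_mean = real n * high_mass / \<mu>"
definition "false_mean = real n * false_high_mass / (1 - \<mu>)"

text \<open>The state is drawn first, then the number of high signals from the two-point law of that
  state, then a uniform cyclic shift that makes the agents exchangeable in their marginals.\<close>

definition two_point :: "nat \<Rightarrow> nat \<Rightarrow> nat \<Rightarrow> nat \<Rightarrow> (bool \<times> signal list) pmf" where
  "two_point i j k l = map_pmf
     (\<lambda>(w, b, c, r). (w, profile n (if w then if b then j else i else if c then l else k) r))
     (pair_pmf (bernoulli_pmf \<mu>) (pair_pmf (bernoulli_pmf (upper_weight true_mean i j))
       (pair_pmf (bernoulli_pmf (upper_weight false_mean k l)) (pmf_of_set {..<n}))))"

context
  fixes i j k l :: nat
  assumes ij: "i < j" "j \<le> n" "real i \<le> true_mean" "true_mean \<le> real j"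
    and kl: "k < l" "l \<le> n" "real k \<le> false_mean" "false_mean \<le> real l"
begin

lemma upper_weight_bounds:
  "0 \<le> upper_weight true_mean i j" "upper_weight true_mean i j \<le> 1"
  "0 \<le> upper_weight false_mean k l" "upper_weight false_mean k l \<le> 1"
  using ij kl by (auto simp: upper_weight_def field_simps)

lemma expectation_two_point:
  "measure_pmf.expectation (two_point i j k l) F
   = \<mu> * two_point_mean true_mean i j (\<lambda>k. (\<Sum>r<n. F (True, profile n k r)) / real n)
   + (1 - \<mu>) * two_point_mean false_mean k l (\<lambda>k. (\<Sum>r<n. F (False, profile n k r)) / real n)"
proof -
  have fin: "finite (set_pmf (pmf_of_set {..<n}))" using n_pos by (subst set_pmf_of_set) auto
  have finb: "finite (set_pmf p)" for p :: "bool pmf" by (rule finite_subset[OF subset_UNIV]) simp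
  define avg where "avg = (\<lambda>g :: nat \<Rightarrow> real. (\<Sum>r<n. g r) / real n)"
  have avg: "(\<Sum>r<n. g r) / real n = avg g" for g by (simp add: avg_def)
  have int: "measure_pmf.expectation (pmf_of_set {..<n}) g = avg g" for g :: "nat \<Rightarrow> real"
    using n_pos by (subst integral_pmf_of_set) (auto simp: avg_def)
  show ?thesis
    using upper_weight_bounds \<mu>_bounds unfolding avg
    by (simp add: two_point_def expectation_pair_pmf_finite fin finb int two_point_mean_def)
      (simp add: algebra_simps)
qed

lemma set_two_point:
  assumes "x \<in> set_pmf (two_point i j k l)"
  obtains r where "snd x = profile n j r \<or> snd x = profile n i r" "fst x"
  | r where "snd x = profile n l r \<or> snd x = profile n k r" "\<not> fst x"
  using assms unfolding two_point_def by (force split: if_splits)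

lemma prob_two_point:
  "\<P>(x in measure_pmf (two_point i j k l). Q x)
   = \<mu> * two_point_mean true_mean i j (\<lambda>k. (\<Sum>r<n. of_bool (Q (True, profile n k r))) / real n)
   + (1 - \<mu>) * two_point_mean false_mean k l (\<lambda>k. (\<Sum>r<n. of_bool (Q (False, profile n k r))) / real n)"
  unfolding expectation_of_bool_pmf[symmetric] by (rule expectation_two_point)

text \<open>The joint masses of state and signal come out as \<open>high_mass\<close> and
  \<open>false_high_mass\<close>; by \<open>prior_split\<close> these give the required
  posteriors.\<close>

lemma two_point_in_info_structures: "two_point i j k l \<in> info_structures n \<mu> p1 p2"
proof -
  let ?P = "\<lambda>Q. \<P>(x in measure_pmf (two_point i j k l). Q x)"
  have LH: "s = L \<longleftrightarrow> s \<noteq> H" for s by (cases s) auto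
  \<comment> \<open>Averaged over shifts, agent \<open>t\<close> is high with probability
    \<open>k / n\<close>, which is linear in \<open>k\<close>, so only the mean \<open>m\<close>
    survives.\<close>
  have mean: "two_point_mean m i' j' (\<lambda>k. (\<Sum>r<n. of_bool (profile n k r ! t = H)) / real n) = m / real n"
    if "t < n" "i' < j'" "j' \<le> n" for m i' j' t
  proof -
    have "two_point_mean m i' j' (\<lambda>k. (\<Sum>r<n. of_bool (profile n k r ! t = H)) / real n)
        = two_point_mean m i' j' real / real n"
      using that sum_profile_nth[of i' n t] sum_profile_nth[of j' n t]
      by (simp add: two_point_mean_def add_divide_distrib del: sum_of_bool_eq nth_profile)
    then show ?thesis using that by (simp add: two_point_mean_of_nat)
  qed
  have true: "?P (\<lambda>x. fst x \<and> snd x ! t = H) = high_mass"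
    and false: "?P (\<lambda>x. \<not> fst x \<and> snd x ! t = H) = false_high_mass" if "t < n" for t
    unfolding prob_two_point
    using mean[OF that] ij kl \<mu>_bounds n_pos
    by (simp_all add: true_mean_def false_mean_def del: sum_of_bool_eq nth_profile)
  have f: "?P fst = \<mu>" unfolding prob_two_point using n_pos by simp
  note add = prob_pmf_split[of "two_point i j k l"]
  have high: "?P (\<lambda>x. snd x ! t = H) = high_prob" if "t < n" for t
    using add[of "\<lambda>x. snd x ! t = H" fst] true[OF that] false[OF that]
    by (simp add: conj_commute high_mass_def false_high_mass_def algebra_simps)
  have low: "?P (\<lambda>x. snd x ! t \<noteq> H) = 1 - high_prob" if "t < n" for t
    using add[of "\<lambda>_. True" "\<lambda>x. snd x ! t = H"] high[OF that] by simp
  have true_low: "?P (\<lambda>x. fst x \<and> snd x ! t \<noteq> H) = (1 - high_prob) * p1" if "t < n" for t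
    using add[of fst "\<lambda>x. snd x ! t = H"] true[OF that] f prior_split by (simp add: high_mass_def)
  have "set_pmf (two_point i j k l) \<subseteq> UNIV \<times> {s. length s = n}"
    by (auto elim!: set_two_point)
  then show ?thesis
    unfolding info_structures_def
    using f high low true true_low high_prob_bounds
    by (auto simp: cond_prob_def LH high_mass_def)
qed

text \<open>Disjoint supports reveal the state, so the Bayesian score is 1 and the regret bound says
  that \<open>f\<close> scores at least \<open>dictator_score\<close>; by
  \<open>prob_correct_split\<close> the deviation term is then nonnegative.\<close>

lemma two_point_inequality:
  assumes f: "f \<in> aggregation_rules n"
    and reg: "regret n \<mu> p1 p2 f \<le> 1 - dictator_score"
    and disj: "{i, j} \<inter> {k, l} = {}"
  defines "e \<equiv> \<lambda>k. f (real k / real n) - real k / real n"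
  shows "(1 - \<mu>) * two_point_mean false_mean k l e \<le> \<mu> * two_point_mean true_mean i j e"
proof -
  have "fst x = fst y" if "x \<in> set_pmf (two_point i j k l)" "y \<in> set_pmf (two_point i j k l)"
    "high_fraction n (snd x) = high_fraction n (snd y)" for x y
    using that disj ij kl n_pos
    by (elim set_two_point) (auto simp: high_fraction_profile)
  then have b: "bayes_prob_correct n (two_point i j k l) = 1" by (rule bayes_eq_1)
  have "dictator_score \<le> prob_correct n \<mu> f (two_point i j k l)"
    using regret_at_le_regret[OF f two_point_in_info_structures] reg b by (simp add: regret_at_def)
  then show ?thesis
    using ij kl n_pos
    by (simp add: prob_correct_split[OF two_point_in_info_structures] expectation_two_point
        two_point_mean_def high_fraction_profile e_def) (simp add: algebra_simps)
qed

end

section \<open>Uniqueness of the minimizer\<close>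

lemma means: "\<mu> * true_mean = real n * (high_prob * p2)"
  "(1 - \<mu>) * false_mean = real n * (high_prob * (1 - p2))"
  using \<mu>_bounds by (auto simp: true_mean_def false_mean_def high_mass_def false_high_mass_def)

text \<open>A high signal raises the belief in state 1 above the prior, hence is likelier in state
  1.\<close>

lemma false_mean_less_true_mean: "false_mean < true_mean"
proof -
  have "(1 - p2) * \<mu> < p2 * (1 - \<mu>)" using \<mu>_less_p2 by (simp add: algebra_simps)
  then have "(1 - p2) / (1 - \<mu>) < p2 / \<mu>" using \<mu>_bounds by (simp add: field_simps)
  then have "real n * high_prob * ((1 - p2) / (1 - \<mu>)) < real n * high_prob * (p2 / \<mu>)"
    using n_pos high_prob_bounds by (intro mult_strict_left_mono) auto
  then show ?thesis
    by (simp add: true_mean_def false_mean_def high_mass_def false_high_mass_def)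
qed

text \<open>The random dictator has regret at most \<open>1 - dictator_score\<close>, and it is the
  only rule with that property; its exact regret need not be computed.\<close>

lemma regret_minimizers_eq:
  assumes p: "p1 < 1 / 2" "1 / 2 < p2"
    and n_false: "1 \<le> false_mean" and n_true: "true_mean \<le> real n - 1"
  shows "regret_minimizers n \<mu> p1 p2 = {random_dictator n}"
proof -
  have n: "2 < n" using false_mean_less_true_mean n_false n_true by linarith
  have unique: "f = random_dictator n"
    if f: "f \<in> aggregation_rules n" and reg: "regret n \<mu> p1 p2 f \<le> 1 - dictator_score" for f
  proof -
    define e where "e = (\<lambda>k. f (real k / real n) - real k / real n)"
    have range: "f (real k / real n) \<in> {0..1}" if "k \<le> n" for k
    proof -
      have "real k / real n \<in> fractions n" using that by (auto simp: fractions_def)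
      then show ?thesis by (rule PiE_mem[OF f[unfolded aggregation_rules_def]])
    qed
    have zero: "e k = 0" if k: "k \<le> n" for k
    proof (rule two_point_inequalities_imp_zero[OF _ n_false false_mean_less_true_mean n_true \<mu>_bounds _ _ _ _ k])
      fix i j k l
      assume "i < j" "j \<le> n" "real i \<le> true_mean" "true_mean \<le> real j"
        "k < l" "l \<le> n" "real k \<le> false_mean" "false_mean \<le> real l" "{i, j} \<inter> {k, l} = {}"
      then show "(1 - \<mu>) * two_point_mean false_mean k l e \<le> \<mu> * two_point_mean true_mean i j e"
        unfolding e_def using f reg by (intro two_point_inequality)
    next
      \<comment> \<open>By \<open>means\<close> this amounts to \<open>1 - p2 < p2\<close>.\<close>
      show "(1 - \<mu>) * false_mean < \<mu> * true_mean"
        unfolding means using n_pos high_prob_bounds p by simp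
      \<comment> \<open>The counterpart for low signals, which amounts to
        \<open>p1 < 1 - p1\<close>.\<close>
      have "\<mu> * (real n - true_mean) = real n * (\<mu> - high_prob * p2)"
        using means(1) by (simp add: algebra_simps)
      also have "\<dots> = real n * ((1 - high_prob) * p1)" using prior_split by (metis add_diff_cancel_left')
      also have "\<dots> < real n * ((1 - high_prob) * (1 - p1))"
        using n_pos high_prob_bounds p by simp
      also have "(1 - high_prob) * (1 - p1) = 1 - \<mu> - high_prob * (1 - p2)"
        using prior_split by (simp add: algebra_simps)
      also have "real n * (1 - \<mu> - high_prob * (1 - p2)) = (1 - \<mu>) * (real n - false_mean)"
        using means(2) by (simp add: algebra_simps)
      finally show "\<mu> * (real n - true_mean) < (1 - \<mu>) * (real n - false_mean)" .
      show "0 \<le> e 0" "e n \<le> 0" using range[of 0] range[of n] n_pos by (auto simp: e_def)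
    qed
    show ?thesis
    proof
      fix x show "f x = random_dictator n x"
      proof (cases "x \<in> fractions n")
        case True
        then obtain k where "k \<le> n" "x = real k / real n" by (auto simp: fractions_def)
        then show ?thesis using zero[of k] True by (simp add: e_def random_dictator_def)
      next
        case False
        then show ?thesis
          using PiE_arb[OF f[unfolded aggregation_rules_def]] by (simp add: random_dictator_def)
      qed
    qed
  qed
  \<comment> \<open>Any member would do: it shows that the supremum is over a nonempty set.\<close>
  have "two_point 0 n 1 (n - 1) \<in> info_structures n \<mu> p1 p2"
    using n n_false n_true false_mean_less_true_mean by (intro two_point_in_info_structures) auto
  then have dictator: "regret n \<mu> p1 p2 (random_dictator n) \<le> 1 - dictator_score"
    by (intro regret_random_dictator_le) auto
  have rule: "random_dictator n \<in> aggregation_rules n"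
    using n_pos by (auto simp: random_dictator_def aggregation_rules_def fractions_def divide_le_eq)
  show ?thesis
  proof (intro equalityI subsetI)
    fix f assume "f \<in> regret_minimizers n \<mu> p1 p2"
    then have "f \<in> aggregation_rules n" "regret n \<mu> p1 p2 f \<le> regret n \<mu> p1 p2 (random_dictator n)"
      using rule by (auto simp: regret_minimizers_def is_arg_min_def not_less)
    then show "f \<in> {random_dictator n}" using unique dictator by force
  next
    fix f assume "f \<in> {random_dictator n}"
    moreover have False
      if "g \<in> aggregation_rules n" "regret n \<mu> p1 p2 g < regret n \<mu> p1 p2 (random_dictator n)" for g
      using unique[of g] that dictator by auto
    ultimately show "f \<in> regret_minimizers n \<mu> p1 p2"
      using rule by (auto simp: regret_minimizers_def is_arg_min_def)
  qed
qed

end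

section \<open>The threshold as a condition on the conditional means\<close>

theorem corollary4p4:
  fixes \<mu> p1 p2 :: real
  assumes "\<mu> \<in> {0..1}" and "p1 \<in> {0..1}" and "p2 \<in> {0..1}"
    and "p1 < 1 / 2" and "1 / 2 < p2"
    and "p1 < \<mu>" and "\<mu> < p2"
  shows "\<exists>N::ereal. N = threshold \<mu> p1 p2 \<and>
           (N = \<infinity> \<longleftrightarrow> p1 = 0 \<or> p2 = 1) \<and>
           (\<forall>n::nat. 1 \<le> n \<and> N \<le> ereal (real n) \<longrightarrow>
              regret_minimizers n \<mu> p1 p2 = {random_dictator n})"
proof -
  have \<mu>: "0 < \<mu>" "\<mu> < 1" using assms by auto
  have num: "0 < (1 - \<mu>) * (p2 - p1)" "0 < \<mu> * (p2 - p1)" using assms \<mu> by auto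
  have inf: "threshold \<mu> p1 p2 = \<infinity> \<longleftrightarrow> p1 = 0 \<or> p2 = 1"
  proof (cases "p1 = 0 \<or> p2 = 1")
    case True
    have div0: "ereal x / ereal y = \<infinity>" if "0 < x" "y = 0" for x y
      using that by (simp add: divide_ereal_def zero_ereal_def[symmetric])
    from True have "threshold \<mu> p1 p2 = \<infinity>"
    proof
      assume "p1 = 0"
      then have "ereal (\<mu> * (p2 - p1)) / ereal (p1 * (p2 - \<mu>)) = \<infinity>"
        by (intro div0 num) simp
      then show ?thesis by (simp only: threshold_def max_absorb2 ereal_less_eq)
    next
      assume "p2 = 1"
      then have "ereal ((1 - \<mu>) * (p2 - p1)) / ereal ((1 - p2) * (\<mu> - p1)) = \<infinity>"
        by (intro div0 num) simp
      then show ?thesis by (simp only: threshold_def max_absorb1 ereal_less_eq)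
    qed
    with True show ?thesis by simp
  next
    case False
    then have "(1 - p2) * (\<mu> - p1) \<noteq> 0" "p1 * (p2 - \<mu>) \<noteq> 0" using assms by auto
    then have "threshold \<mu> p1 p2 \<noteq> \<infinity>"
      unfolding threshold_def max_def by (simp add: if_split)
    with False show ?thesis by simp
  qed
  have "regret_minimizers n \<mu> p1 p2 = {random_dictator n}"
    if n: "1 \<le> n" and le: "threshold \<mu> p1 p2 \<le> ereal (real n)" for n
  proof -
    \<comment> \<open>A threshold below a real number is finite, which by \<open>inf\<close>
      excludes the degenerate posteriors.\<close>
    have p: "0 < p1" "p2 < 1"
      using inf le assms by (auto simp: less_le)
    have le': "(1 - \<mu>) * (p2 - p1) / ((1 - p2) * (\<mu> - p1)) \<le> real n"
      "\<mu> * (p2 - p1) / (p1 * (p2 - \<mu>)) \<le> real n"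
      using le p assms by (simp_all add: threshold_def)
    interpret aggregation_problem n \<mu> p1 p2
      using n p assms by unfold_locales auto
    have pos: "0 < p2 - p1" using assms by simp
    \<comment> \<open>The first entry of the maximum is \<open>n / false_mean\<close>.\<close>
    have 1: "1 \<le> false_mean"
    proof -
      have "(1 - \<mu>) * (p2 - p1) \<le> real n * ((1 - p2) * (\<mu> - p1))"
        using le'(1) p assms by (simp add: pos_divide_le_eq)
      moreover have "false_mean = real n * ((1 - p2) * (\<mu> - p1)) / ((1 - \<mu>) * (p2 - p1))"
        by (simp add: false_mean_def false_high_mass_def high_prob_def mult_ac)
      ultimately show ?thesis using num(1) by (simp only: pos_le_divide_eq mult_1)
    qed
    \<comment> \<open>The second entry is \<open>n / (n - true_mean)\<close>, because
      \<open>\<mu> * (n - true_mean)\<close> equals \<open>n * (1 - high_prob) * p1\<close>.\<close>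
    have 2: "true_mean \<le> real n - 1"
    proof -
      have "\<mu> * (p2 - p1) \<le> real n * (p1 * (p2 - \<mu>))"
        using le'(2) p assms by (simp add: pos_divide_le_eq)
      moreover have "(1 - high_prob) * (p2 - p1) = p2 - \<mu>"
        using pos by (simp add: high_prob_def field_simps)
      ultimately have "\<mu> * (p2 - p1) \<le> real n * ((1 - high_prob) * p1) * (p2 - p1)"
        by (simp add: mult_ac)
      then have "\<mu> \<le> real n * ((1 - high_prob) * p1)" using pos by simp
      also have "(1 - high_prob) * p1 = \<mu> - high_prob * p2" using prior_split by linarith
      finally have "real n * (high_prob * p2) \<le> (real n - 1) * \<mu>" by (simp add: algebra_simps)
      then show ?thesis using \<mu> by (simp add: true_mean_def high_mass_def pos_divide_le_eq)
    qed
    show ?thesis using assms 1 2 by (intro regret_minimizers_eq) auto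
  qed
  with inf show ?thesis by auto
qed

end
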